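(* Let $G$ and $H$ be finite isoclinic groups. If $G$ is a GVZ-group, then $H$ is a GVZ-group; and if $G$ is a nested GVZ-group, then $H$ is a nested GVZ-group.
   Context: Two finite groups $G,H$ are isoclinic if there are isomorphisms $\theta:G/Z(G)\to H/Z(H)$ and $\phi:G'\to H'$ such that for all $g_1,g_2\in G$, whenever $h_1\in\theta(g_1Z(G))$ and $h_2\in\theta(g_2Z(G))$, one has $\phi([g_1,g_2])=[h_1,h_2]$, where $[g,h]=g^{-1}h^{-1}gh$ and $G'=[G,G]$. For $\chi\in\operatorname{Irr}(G)$ (irreducible complex characters), $Z(\chi)=\{g\in G:|\chi(g)|=\chi(1)\}$. $G$ is a GVZ-group if every $\chi\in\operatorname{Irr}(G)$ satisfies $\chi(g)=0$ for all $g\in G\setminus Z(\chi)$. $G$ is nested if for all $\chi,\psi\in\operatorname{Irr}(G)$, $Z(\chi)\subseteq Z(\psi)$ or $Z(\psi)\subseteq Z(\chi)$; a nested GVZ-group is a nested group that is a GVZ-group. *)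

theory Defs
  imports "HOL-Algebra.Coset" "HOL-Algebra.Generated_Groups" "Jordan_Normal_Form.Matrix"
begin

definition commutator :: "('a, 'b) monoid_scheme \<Rightarrow> 'a \<Rightarrow> 'a \<Rightarrow> 'a" where
  "commutator G g h = inv\<^bsub>G\<^esub> g \<otimes>\<^bsub>G\<^esub> inv\<^bsub>G\<^esub> h \<otimes>\<^bsub>G\<^esub> g \<otimes>\<^bsub>G\<^esub> h"

definition center :: "('a, 'b) monoid_scheme \<Rightarrow> 'a set" where
  "center G = {z \<in> carrier G. \<forall>g \<in> carrier G. z \<otimes>\<^bsub>G\<^esub> g = g \<otimes>\<^bsub>G\<^esub> z}"

definition derived_group :: "('a, 'b) monoid_scheme \<Rightarrow> ('a, 'b) monoid_scheme" where
  "derived_group G = G\<lparr>carrier := derived G (carrier G)\<rparr>"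

definition isoclinic :: "('a, 'c) monoid_scheme \<Rightarrow> ('b, 'd) monoid_scheme \<Rightarrow> bool" where
  "isoclinic G H \<longleftrightarrow>
     (\<exists>\<theta> \<phi>. \<theta> \<in> iso (G Mod center G) (H Mod center H) \<and>
            \<phi> \<in> iso (derived_group G) (derived_group H) \<and>
            (\<forall>g1 \<in> carrier G. \<forall>g2 \<in> carrier G. \<forall>h1 h2.
               h1 \<in> \<theta> (center G #>\<^bsub>G\<^esub> g1) \<and> h2 \<in> \<theta> (center G #>\<^bsub>G\<^esub> g2) \<longrightarrow>
               \<phi> (commutator G g1 g2) = commutator H h1 h2))"

definition mat_trace :: "'a::comm_ring_1 mat \<Rightarrow> 'a" where
  "mat_trace A = (\<Sum>i<dim_row A. A $$ (i, i))"

definition is_rep :: "('a, 'b) monoid_scheme \<Rightarrow> nat \<Rightarrow> ('a \<Rightarrow> complex mat) \<Rightarrow> bool" where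
  "is_rep G n \<rho> \<longleftrightarrow>
     (\<forall>g \<in> carrier G. \<rho> g \<in> carrier_mat n n) \<and>
     (\<forall>g \<in> carrier G. \<forall>h \<in> carrier G. \<rho> (g \<otimes>\<^bsub>G\<^esub> h) = \<rho> g * \<rho> h) \<and>
     \<rho> \<one>\<^bsub>G\<^esub> = 1\<^sub>m n"

definition invariant_subspace ::
  "('a, 'b) monoid_scheme \<Rightarrow> nat \<Rightarrow> ('a \<Rightarrow> complex mat) \<Rightarrow> complex vec set \<Rightarrow> bool" where
  "invariant_subspace G n \<rho> W \<longleftrightarrow>
     W \<subseteq> carrier_vec n \<and> 0\<^sub>v n \<in> W \<and>
     (\<forall>v \<in> W. \<forall>w \<in> W. v + w \<in> W) \<and>
     (\<forall>c. \<forall>v \<in> W. c \<cdot>\<^sub>v v \<in> W) \<and>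
     (\<forall>g \<in> carrier G. \<forall>v \<in> W. \<rho> g *\<^sub>v v \<in> W)"

definition irreducible_rep :: "('a, 'b) monoid_scheme \<Rightarrow> nat \<Rightarrow> ('a \<Rightarrow> complex mat) \<Rightarrow> bool" where
  "irreducible_rep G n \<rho> \<longleftrightarrow>
     n > 0 \<and> is_rep G n \<rho> \<and>
     (\<forall>W. invariant_subspace G n \<rho> W \<longrightarrow> W = {0\<^sub>v n} \<or> W = carrier_vec n)"

definition Irr :: "('a, 'b) monoid_scheme \<Rightarrow> ('a \<Rightarrow> complex) set" where
  "Irr G = {\<chi>. \<exists>n \<rho>. irreducible_rep G n \<rho> \<and>
              \<chi> = (\<lambda>g. if g \<in> carrier G then mat_trace (\<rho> g) else 0)}"

definition char_center :: "('a, 'b) monoid_scheme \<Rightarrow> ('a \<Rightarrow> complex) \<Rightarrow> 'a set" where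
  "char_center G \<chi> = {g \<in> carrier G. complex_of_real (cmod (\<chi> g)) = \<chi> \<one>\<^bsub>G\<^esub>}"

definition GVZ :: "('a, 'b) monoid_scheme \<Rightarrow> bool" where
  "GVZ G \<longleftrightarrow> (\<forall>\<chi> \<in> Irr G. \<forall>g \<in> carrier G - char_center G \<chi>. \<chi> g = 0)"

definition nested :: "('a, 'b) monoid_scheme \<Rightarrow> bool" where
  "nested G \<longleftrightarrow> (\<forall>\<chi> \<in> Irr G. \<forall>\<psi> \<in> Irr G.
      char_center G \<chi> \<subseteq> char_center G \<psi> \<or> char_center G \<psi> \<subseteq> char_center G \<chi>)"

end

theory Submission
  imports Defs "HOL-Algebra.Multiplicative_Group" "Jordan_Normal_Form.Spectral_Radius"
begin

text \<open>
  Let \<open>K\<close> be the fibre product of \<open>G\<close> and \<open>H\<close> over the common quotient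
  \<open>G/Z(G) \<cong> H/Z(H)\<close>. By Schur's lemma an irreducible representation \<open>\<sigma>\<close> of \<open>H\<close> restricts to a
  linear character \<open>l\<close> on \<open>Z(H)\<close>. Since \<open>\<phi>\<close> matches commutators, the commutator subgroup of \<open>K\<close> lies
  on the graph of \<open>\<phi>\<close> and so meets \<open>1 \<times> Z(H)\<close> trivially; hence \<open>l\<close> extends to a linear character
  \<open>\<mu>\<close> of \<open>K\<close>. Then \<open>\<mu>(g, h)\<inverse> \<sigma>(h)\<close> depends only on \<open>g\<close> and is an irreducible representation of
  \<open>G\<close>, whose character has the same absolute values as that of \<open>\<sigma>\<close> along \<open>K\<close>. Both properties in
  question only depend on these absolute values.
\<close>

section \<open>Preliminaries: subgroups of finite groups, commutators, complex roots\<close>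

text \<open>Inverses come for free: if the group order is \<open>n + 1\<close>, then
  \<open>a [^] n\<close> is the inverse of \<open>a\<close>, and closure under products keeps it in
  \<open>S\<close>.\<close>

lemma (in group) finite_closed_subgroup:
  assumes "finite (carrier G)" "S \<subseteq> carrier G" "\<one> \<in> S"
    and closed: "\<And>x y. x \<in> S \<Longrightarrow> y \<in> S \<Longrightarrow> x \<otimes> y \<in> S"
  shows "subgroup S G"
proof (rule subgroupI)
  fix a assume a: "a \<in> S"
  have pow: "a [^] n \<in> S" for n :: nat
    by (induction n) (use assms a in auto)
  have "Coset.order G > 0"
    using assms by (simp add: order_gt_0_iff_finite)
  then obtain n where n: "Coset.order G = Suc n"
    using gr0_implies_Suc by blast
  have "a [^] n \<otimes> a = \<one>"
    using pow_order_eq_1[of a] a assms(2) n by auto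
  then have "inv a = a [^] n"
    using a assms(2) by (metis inv_equality nat_pow_closed subsetD)
  then show "inv a \<in> S"
    using pow by simp
qed (use assms in auto)

text \<open>The factor in front of \<open>y \<otimes> x\<close> is a commutator in the form that
  generates \<open>derived\<close>. This supplies the shape
  \<open>x \<otimes> y = c \<otimes> (y \<otimes> x)\<close> that \<open>extend_character\<close>
  asks for.\<close>

lemma (in group) commutator_swap:
  assumes "x \<in> carrier G" "y \<in> carrier G"
  shows "x \<otimes> y \<otimes> inv x \<otimes> inv y \<otimes> (y \<otimes> x) = x \<otimes> y"
proof -
  have "inv y \<otimes> (y \<otimes> x) = x"
    using assms by (simp flip: m_assoc)
  then have "inv x \<otimes> (inv y \<otimes> (y \<otimes> x)) = \<one>"
    using assms by simp
  then show ?thesis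
    using assms by (simp add: m_assoc)
qed

lemma complex_root_exists:
  assumes "m > 0"
  obtains c :: complex where "c ^ m = w"
proof
  show "rcis (root m (cmod w)) (Arg w / m) ^ m = w"
    using assms by (simp add: DeMoivre2 rcis_cmod_Arg)
qed

section \<open>Extending linear characters from subgroups that contain all commutators\<close>

text \<open>The constant 0 also qualifies, so \<open>f \<one> = 1\<close> or nonvanishing is assumed
  separately where a character is meant.\<close>

definition multiplicative_on :: "('a, 'b) monoid_scheme \<Rightarrow> 'a set \<Rightarrow> ('a \<Rightarrow> 'c::monoid_mult) \<Rightarrow> bool" where
  "multiplicative_on G S f \<longleftrightarrow> (\<forall>x\<in>S. \<forall>y\<in>S. f (x \<otimes>\<^bsub>G\<^esub> y) = f x * f y)"

lemma (in group) multiplicative_on_pow: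
  assumes "subgroup M G" "multiplicative_on G M f" "f \<one> = 1" "x \<in> M"
  shows "f (x [^] (n::nat)) = f x ^ n"
proof -
  have mem: "x [^] k \<in> M" for k :: nat
    by (induction k) (use assms in \<open>auto intro: subgroup.one_closed subgroup.m_closed\<close>)
  show ?thesis
  proof (induction n)
    case (Suc n)
    have "f (x [^] n \<otimes> x) = f (x [^] n) * f x"
      using assms mem[of n] unfolding multiplicative_on_def by blast
    then show ?case
      using Suc by (simp add: power_commutes)
  qed (use assms in simp)
qed

text \<open>
  The value \<open>c\<close> of the extension at \<open>a\<close> is an \<open>m\<close>-th root of \<open>f (a ^ m)\<close>, where \<open>a ^ m\<close> is the least
  positive power of \<open>a\<close> in \<open>M\<close>.
\<close>
lemma (in group) extend_character_step:
  fixes f :: "'a \<Rightarrow> complex"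
  assumes fin: "finite (carrier G)" and M: "subgroup M G"
    and f: "multiplicative_on G M f" "f \<one> = 1"
    and comm: "\<And>x y. x \<in> carrier G \<Longrightarrow> y \<in> carrier G \<Longrightarrow>
        \<exists>c\<in>M. f c = 1 \<and> x \<otimes> y = c \<otimes> (y \<otimes> x)"
    and a: "a \<in> carrier G"
  shows "\<exists>M' f'. subgroup M' G \<and> insert a M \<subseteq> M' \<and> multiplicative_on G M' f' \<and> (\<forall>x\<in>M. f' x = f x)"
proof -
  interpret M: subgroup M G by fact
  have fmult: "f (x \<otimes> y) = f x * f y" if "x \<in> M" "y \<in> M" for x y
    using f that by (simp add: multiplicative_on_def)
  have Mc: "x \<in> carrier G" if "x \<in> M" for x
    using that M.subset by auto
  define m where "m = (LEAST n. n > 0 \<and> a [^] (n::nat) \<in> M)"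
  have "Coset.order G > 0"
    using fin by (simp add: order_gt_0_iff_finite)
  then have "Coset.order G > 0 \<and> a [^] Coset.order G \<in> M"
    using pow_order_eq_1[OF a] by simp
  then have m: "m > 0" "a [^] m \<in> M"
    unfolding m_def by (metis (mono_tags, lifting) LeastI)+
  have m_least: "\<not> (n > 0 \<and> a [^] n \<in> M)" if "n < m" for n :: nat
    using that unfolding m_def by (rule not_less_Least)
  have f_pow: "f (x [^] n) = f x ^ n" if "x \<in> M" for x and n :: nat
    by (rule multiplicative_on_pow[OF M f that])
  have mem_pow: "x [^] k \<in> M" if "x \<in> M" for x and k :: nat
    by (induction k) (use that in auto)
  have f_nz: "f x \<noteq> 0" if "x \<in> M" for x
    using fmult[OF that M.m_inv_closed[OF that]] that Mc f(2) by auto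
  obtain c where c: "c ^ m = f (a [^] m)"
    using complex_root_exists[OF m(1)] by metis
  \<comment> \<open>Compatibility of \<open>c\<close> with \<open>f\<close>: dividing
    \<open>d\<close> by \<open>m\<close> leaves a remainder \<open>r\<close> with
    \<open>a [^] r\<close> in \<open>M\<close>, and minimality of \<open>m\<close> forces
    \<open>r = 0\<close>.\<close>
  have f_apow: "f (a [^] d) = c ^ d" if d: "a [^] d \<in> M" for d :: nat
  proof -
    define q r where "q = d div m" and "r = d mod m"
    have dqr: "d = m * q + r" and r: "r < m"
      using m(1) by (auto simp: q_def r_def)
    have q: "a [^] (m * q) = (a [^] m) [^] q"
      by (simp add: nat_pow_pow a)
    have qM: "a [^] (m * q) \<in> M"
      unfolding q using m(2) by (rule mem_pow)
    have "a [^] d = a [^] (m * q) \<otimes> a [^] r"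
      by (simp add: dqr nat_pow_mult a)
    then have "a [^] r = inv (a [^] (m * q)) \<otimes> a [^] d"
      using a by (metis inv_solve_left nat_pow_closed)
    then have "a [^] r \<in> M"
      using qM d by simp
    then have "r = 0"
      using m_least[OF r] by auto
    then show ?thesis
      using q dqr c f_pow[OF m(2), of q] by (simp add: power_mult)
  qed
  \<comment> \<open>Cancelling the smaller power of \<open>a\<close> leaves a power of
    \<open>a\<close> in \<open>M\<close>, where \<open>f_apow\<close> applies.\<close>
  have wd_le: "f x * c ^ i = f y * c ^ j"
    if "x \<in> M" "y \<in> M" "i \<le> j" "x \<otimes> a [^] i = y \<otimes> a [^] j" for x y and i j :: nat
  proof -
    have "y \<otimes> a [^] j = (y \<otimes> a [^] (j - i)) \<otimes> a [^] i"
      using that a Mc by (simp add: m_assoc nat_pow_mult)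
    then have x: "x = y \<otimes> a [^] (j - i)"
      using that a Mc by (metis m_closed nat_pow_closed right_cancel)
    then have "a [^] (j - i) = inv y \<otimes> x"
      using that a Mc by (metis inv_solve_left nat_pow_closed)
    then have aM: "a [^] (j - i) \<in> M"
      using that by simp
    have "f x = f y * c ^ (j - i)"
      using x fmult[OF that(2) aM] f_apow[OF aM] by simp
    then show ?thesis
      using that(3) by (simp add: mult.assoc flip: power_add)
  qed
  have wd: "f x * c ^ i = f y * c ^ j"
    if "x \<in> M" "y \<in> M" "x \<otimes> a [^] i = y \<otimes> a [^] j" for x y and i j :: nat
    using wd_le[of x y i j] wd_le[of y x j i] that by (cases "i \<le> j") auto
  \<comment> \<open>Natural exponents suffice because the group is finite. \<open>f'\<close> picks
    an arbitrary decomposition of \<open>z\<close>; by \<open>wd\<close> the value does not depend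
    on it.\<close>
  define M' where "M' = {x \<otimes> a [^] i | x i. x \<in> M \<and> i \<in> (UNIV :: nat set)}"
  define f' where "f' z = (SOME w. \<exists>x i. x \<in> M \<and> z = x \<otimes> a [^] (i::nat) \<and> w = f x * c ^ i)" for z
  have f': "f' (x \<otimes> a [^] i) = f x * c ^ i" if "x \<in> M" for x and i :: nat
  proof -
    have "\<exists>x' i'. x' \<in> M \<and> x \<otimes> a [^] i = x' \<otimes> a [^] (i'::nat) \<and> f' (x \<otimes> a [^] i) = f x' * c ^ i'"
      unfolding f'_def by (rule someI[where x = "f x * c ^ i"]) (use that in blast)
    then show ?thesis
      using wd[OF that] by metis
  qed
  \<comment> \<open>Moving \<open>a [^] i\<close> past \<open>y\<close> costs a factor
    \<open>d\<close> with \<open>f d = 1\<close>, so \<open>M'\<close> is closed under products and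
    the values multiply.\<close>
  have prod: "\<exists>y'\<in>M. f y' = f x * f y \<and> (x \<otimes> a [^] i) \<otimes> (y \<otimes> a [^] j) = y' \<otimes> a [^] (i + j)"
    if xy: "x \<in> M" "y \<in> M" for x y and i j :: nat
  proof -
    obtain d where d: "d \<in> M" "f d = 1" "a [^] i \<otimes> y = d \<otimes> (y \<otimes> a [^] i)"
      using comm[of "a [^] i" y] a Mc[OF xy(2)] by auto
    have "(x \<otimes> a [^] i) \<otimes> (y \<otimes> a [^] j) = x \<otimes> (a [^] i \<otimes> y) \<otimes> a [^] j"
      using xy d(1) a Mc by (simp add: m_assoc)
    also have "\<dots> = (x \<otimes> (d \<otimes> y)) \<otimes> a [^] (i + j)"
      unfolding d(3) using xy d(1) a Mc by (simp add: m_assoc flip: nat_pow_mult)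
    finally show ?thesis
      using xy d fmult by (intro bexI[of _ "x \<otimes> (d \<otimes> y)"]) auto
  qed
  have "subgroup M' G"
  proof (rule finite_closed_subgroup[OF fin])
    show "M' \<subseteq> carrier G"
      using a Mc by (auto simp: M'_def)
    have "\<one> = \<one> \<otimes> a [^] (0::nat)"
      by simp
    then show "\<one> \<in> M'"
      unfolding M'_def using M.one_closed by blast
    show "u \<otimes> v \<in> M'" if "u \<in> M'" "v \<in> M'" for u v
      using that prod unfolding M'_def by blast
  qed
  moreover have "a \<in> M'"
  proof -
    have "a = \<one> \<otimes> a [^] (1::nat)"
      using a by simp
    then show ?thesis
      unfolding M'_def using M.one_closed by blast
  qed
  moreover have base: "x = x \<otimes> a [^] (0::nat)" if "x \<in> M" for x
    using Mc that by simp
  then have "M \<subseteq> M'"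
    unfolding M'_def by blast
  moreover have "multiplicative_on G M' f'"
    unfolding multiplicative_on_def
  proof (intro ballI)
    fix u v assume "u \<in> M'" "v \<in> M'"
    then obtain x y and i j :: nat where *: "x \<in> M" "y \<in> M" "u = x \<otimes> a [^] i" "v = y \<otimes> a [^] j"
      unfolding M'_def by blast
    then show "f' (u \<otimes> v) = f' u * f' v"
      using prod[of x y i j] f' by (auto simp: power_add)
  qed
  moreover have "\<forall>x\<in>M. f' x = f x"
    using base f' by (metis mult.right_neutral power_0)
  ultimately show ?thesis
    by (intro exI[of _ M'] exI[of _ f']) auto
qed

text \<open>The hypothesis \<open>comm\<close> says that every commutator lies in \<open>L\<close>
  and is sent to 1 by \<open>f\<close>. Among the subgroups above \<open>L\<close> that carry an
  extension, one of maximal cardinality is the whole group, since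
  \<open>extend_character_step\<close> would enlarge it by any missing element.\<close>

lemma (in group) extend_character:
  fixes f :: "'a \<Rightarrow> complex"
  assumes fin: "finite (carrier G)" and L: "subgroup L G"
    and f: "multiplicative_on G L f" "f \<one> = 1"
    and comm: "\<And>x y. x \<in> carrier G \<Longrightarrow> y \<in> carrier G \<Longrightarrow>
        \<exists>c\<in>L. f c = 1 \<and> x \<otimes> y = c \<otimes> (y \<otimes> x)"
  shows "\<exists>F. multiplicative_on G (carrier G) F \<and> (\<forall>x\<in>L. F x = f x)"
proof -
  define Q where "Q M \<longleftrightarrow> subgroup M G \<and> L \<subseteq> M \<and>
    (\<exists>f'. multiplicative_on G M f' \<and> (\<forall>x\<in>L. f' x = f x))" for M
  have "Q L"
    unfolding Q_def using L f by blast
  moreover have "\<forall>M. Q M \<longrightarrow> card M < Suc (card (carrier G))"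
    using fin by (auto simp: Q_def less_Suc_eq_le intro!: card_mono dest: subgroup.subset)
  ultimately obtain M where M: "Q M" "\<And>N. Q N \<Longrightarrow> card N \<le> card M"
    using ex_has_greatest_nat[of Q L card "Suc (card (carrier G))"] by metis
  then obtain f' where f': "subgroup M G" "L \<subseteq> M" "multiplicative_on G M f'" "\<forall>x\<in>L. f' x = f x"
    unfolding Q_def by blast
  have one: "f' \<one> = 1"
    using f'(4) f(2) subgroup.one_closed[OF L] by simp
  have comm': "\<exists>c\<in>M. f' c = 1 \<and> x \<otimes> y = c \<otimes> (y \<otimes> x)" if "x \<in> carrier G" "y \<in> carrier G" for x y
    using comm[OF that] f' by (metis subsetD)
  have "a \<in> M" if a: "a \<in> carrier G" for a
  proof (rule ccontr)
    assume na: "a \<notin> M"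
    obtain M' f'' where M': "subgroup M' G" "insert a M \<subseteq> M'" "multiplicative_on G M' f''" "\<forall>x\<in>M. f'' x = f' x"
      using extend_character_step[OF fin f'(1,3) one comm' a] by blast
    have "\<forall>x\<in>L. f'' x = f x"
      using M'(4) f'(2,4) by auto
    then have "Q M'"
      unfolding Q_def using M' f'(2) by blast
    then have "card M' \<le> card M"
      by (rule M(2))
    moreover have "finite M'"
      using fin M'(1) finite_subset subgroup.subset by blast
    then have "card M < card M'"
      using M'(2) na by (intro psubset_card_mono) auto
    ultimately show False
      by simp
  qed
  then have "M = carrier G"
    using subgroup.subset[OF f'(1)] by blast
  then show ?thesis
    using f' by blast
qed

text \<open>The values are roots of unity, because \<open>x\<close> raised to the group order is
  \<open>\<one>\<close>.\<close>

lemma (in group) norm_multiplicative: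
  fixes f :: "'a \<Rightarrow> complex"
  assumes "finite (carrier G)" "multiplicative_on G (carrier G) f" "f \<one> = 1" "x \<in> carrier G"
  shows "cmod (f x) = 1"
proof -
  have "f x ^ Coset.order G = 1"
    using multiplicative_on_pow[OF subgroup_self assms(2-4), of "Coset.order G"] pow_order_eq_1[OF assms(4)] assms(3)
    by simp
  moreover have "Coset.order G > 0"
    using assms(1) by (simp add: order_gt_0_iff_finite)
  ultimately show ?thesis
    using power_eq_1_iff[of "f x" "Coset.order G"] by simp
qed

section \<open>Scalar matrices and Schur's lemma for central elements\<close>

lemma smult_mat_mult_vec:
  fixes A :: "'a::comm_ring_1 mat"
  assumes "A \<in> carrier_mat nr n" "v \<in> carrier_vec n"
  shows "(c \<cdot>\<^sub>m A) *\<^sub>v v = c \<cdot>\<^sub>v (A *\<^sub>v v)"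
  using assms by (intro eq_vecI) auto

lemma scalar_matI:
  fixes A :: "'a::comm_ring_1 mat"
  assumes A: "A \<in> carrier_mat n n" and eq: "\<And>v. v \<in> carrier_vec n \<Longrightarrow> A *\<^sub>v v = c \<cdot>\<^sub>v v"
  shows "A = c \<cdot>\<^sub>m 1\<^sub>m n"
proof (rule eq_matI)
  fix i j assume "i < dim_row (c \<cdot>\<^sub>m 1\<^sub>m n :: 'a mat)" "j < dim_col (c \<cdot>\<^sub>m 1\<^sub>m n :: 'a mat)"
  then have ij: "i < n" "j < n"
    by auto
  have "A $$ (i, j) = (A *\<^sub>v unit_vec n j) $ i"
    using A ij by simp
  also have "\<dots> = (c \<cdot>\<^sub>v unit_vec n j) $ i"
    by (subst eq) auto
  finally show "A $$ (i, j) = (c \<cdot>\<^sub>m 1\<^sub>m n) $$ (i, j)"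
    using ij by simp
qed (use A in auto)

text \<open>An eigenspace of \<open>\<rho> z\<close> is invariant because \<open>\<rho> z\<close>
  commutes with every \<open>\<rho> g\<close>. Irreducibility makes it the whole space, so
  \<open>\<rho> z\<close> acts as its eigenvalue.\<close>

lemma schur_central:
  assumes irr: "irreducible_rep G n \<rho>" and z: "z \<in> center G"
  shows "\<exists>c. \<rho> z = c \<cdot>\<^sub>m 1\<^sub>m n"
proof -
  have n: "n > 0" and rep: "is_rep G n \<rho>"
    using irr by (auto simp: irreducible_rep_def)
  have zc: "z \<in> carrier G" and zz: "\<And>g. g \<in> carrier G \<Longrightarrow> z \<otimes>\<^bsub>G\<^esub> g = g \<otimes>\<^bsub>G\<^esub> z"
    using z by (auto simp: center_def)
  have car: "\<And>g. g \<in> carrier G \<Longrightarrow> \<rho> g \<in> carrier_mat n n"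
    and mul: "\<And>g h. g \<in> carrier G \<Longrightarrow> h \<in> carrier G \<Longrightarrow> \<rho> (g \<otimes>\<^bsub>G\<^esub> h) = \<rho> g * \<rho> h"
    using rep by (auto simp: is_rep_def)
  have A: "\<rho> z \<in> carrier_mat n n"
    using car zc by blast
  obtain c v where v: "v \<in> carrier_vec n" "v \<noteq> 0\<^sub>v n" "\<rho> z *\<^sub>v v = c \<cdot>\<^sub>v v"
    using spectrum_non_empty[OF A n] A by (auto simp: spectrum_def eigenvalue_def eigenvector_def)
  define W where "W = {w \<in> carrier_vec n. \<rho> z *\<^sub>v w = c \<cdot>\<^sub>v w}"
  have "invariant_subspace G n \<rho> W"
    unfolding invariant_subspace_def
  proof (intro conjI ballI allI)
    show "W \<subseteq> carrier_vec n"
      by (auto simp: W_def)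
    show "0\<^sub>v n \<in> W"
      using A by (auto simp: W_def)
    show "v + w \<in> W" if "v \<in> W" "w \<in> W" for v w
      using that A by (auto simp: W_def mult_add_distrib_mat_vec smult_add_distrib_vec)
    show "d \<cdot>\<^sub>v v \<in> W" if "v \<in> W" for d v
      using that A by (auto simp: W_def mult_mat_vec smult_smult_assoc mult.commute)
    show "\<rho> g *\<^sub>v w \<in> W" if g: "g \<in> carrier G" and w: "w \<in> W" for g w
    proof -
      have w': "w \<in> carrier_vec n" "\<rho> z *\<^sub>v w = c \<cdot>\<^sub>v w"
        using w by (auto simp: W_def)
      have "\<rho> z *\<^sub>v (\<rho> g *\<^sub>v w) = (\<rho> z * \<rho> g) *\<^sub>v w"
        using A car[OF g] w' by simp
      also have "\<rho> z * \<rho> g = \<rho> g * \<rho> z"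
        using mul zz g zc by metis
      also have "(\<rho> g * \<rho> z) *\<^sub>v w = \<rho> g *\<^sub>v (\<rho> z *\<^sub>v w)"
        using A car[OF g] w' by simp
      also have "\<dots> = c \<cdot>\<^sub>v (\<rho> g *\<^sub>v w)"
        using car[OF g] w' by (simp add: mult_mat_vec)
      finally show ?thesis
        using car[OF g] w' by (auto simp: W_def)
    qed
  qed
  moreover have "W \<noteq> {0\<^sub>v n}"
    using v by (auto simp: W_def)
  ultimately have "W = carrier_vec n"
    using irr unfolding irreducible_rep_def by blast
  then show ?thesis
    using scalar_matI[OF A] unfolding W_def by blast
qed

section \<open>The center and the fibre product over the central quotients\<close>

lemma center_normal:
  assumes "group G"
  shows "center G \<lhd> G"
proof -
  interpret group G by fact
  have cc: "z \<in> carrier G" if "z \<in> center G" for z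
    using that by (simp add: center_def)
  have swap: "z \<otimes>\<^bsub>G\<^esub> g = g \<otimes>\<^bsub>G\<^esub> z" if "z \<in> center G" "g \<in> carrier G" for z g
    using that unfolding center_def by blast
  have "subgroup (center G) G"
  proof (rule subgroupI)
    show "center G \<subseteq> carrier G"
      using cc by blast
    have "\<one>\<^bsub>G\<^esub> \<in> center G"
      by (simp add: center_def)
    then show "center G \<noteq> {}"
      by blast
    show "inv\<^bsub>G\<^esub> z \<in> center G" if z: "z \<in> center G" for z
    proof -
      \<comment> \<open>Obtained by inverting both sides of the commutation of \<open>z\<close> with
        the inverse of \<open>g\<close>.\<close>
      have "inv\<^bsub>G\<^esub> z \<otimes>\<^bsub>G\<^esub> g = g \<otimes>\<^bsub>G\<^esub> inv\<^bsub>G\<^esub> z" if g: "g \<in> carrier G" for g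
        using arg_cong[OF swap[OF z inv_closed[OF g]], of "m_inv G"] cc[OF z] g
        by (simp add: inv_mult_group)
      then show ?thesis
        using inv_closed[OF cc[OF z]] unfolding center_def by blast
    qed
    show "x \<otimes>\<^bsub>G\<^esub> y \<in> center G" if xy: "x \<in> center G" "y \<in> center G" for x y
    proof -
      have "(x \<otimes>\<^bsub>G\<^esub> y) \<otimes>\<^bsub>G\<^esub> g = g \<otimes>\<^bsub>G\<^esub> (x \<otimes>\<^bsub>G\<^esub> y)" if g: "g \<in> carrier G" for g
      proof -
        have "(x \<otimes>\<^bsub>G\<^esub> y) \<otimes>\<^bsub>G\<^esub> g = x \<otimes>\<^bsub>G\<^esub> (g \<otimes>\<^bsub>G\<^esub> y)"
          using cc xy g swap[OF xy(2) g] by (simp add: m_assoc)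
        also have "\<dots> = (g \<otimes>\<^bsub>G\<^esub> x) \<otimes>\<^bsub>G\<^esub> y"
          using m_assoc[of x g y] swap[OF xy(1) g] cc xy g by simp
        finally show ?thesis
          using cc xy g by (simp add: m_assoc)
      qed
      then show ?thesis
        using m_closed[OF cc[OF xy(1)] cc[OF xy(2)]] unfolding center_def by blast
    qed
  qed
  then show ?thesis
  proof (rule normalI, intro ballI)
    fix x assume x: "x \<in> carrier G"
    show "center G #>\<^bsub>G\<^esub> x = x <#\<^bsub>G\<^esub> center G"
      unfolding r_coset_def l_coset_def by (rule SUP_cong) (simp_all add: swap[OF _ x])
  qed
qed

text \<open>Turns isoclinism into a relation \<open>K\<close> between elements: the pairs whose
  central cosets correspond under \<open>\<theta>\<close>. All later arguments work with
  \<open>K\<close> and \<open>\<phi>\<close> instead of cosets.\<close>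

lemma isoclinic_fibre_product:
  assumes G: "group G" and H: "group H" and iso: "isoclinic G H"
  obtains K \<phi> where
    "K \<subseteq> carrier G \<times> carrier H" "fst ` K = carrier G" "snd ` K = carrier H"
    "(\<one>\<^bsub>G\<^esub>, \<one>\<^bsub>H\<^esub>) \<in> K"
    "\<And>k l. k \<in> K \<Longrightarrow> l \<in> K \<Longrightarrow> k \<otimes>\<^bsub>G \<times>\<times> H\<^esub> l \<in> K"
    "\<And>z. (\<one>\<^bsub>G\<^esub>, z) \<in> K \<longleftrightarrow> z \<in> center H"
    "\<phi> \<in> hom (derived_group G) (derived_group H)"
    "\<And>g1 h1 g2 h2. (g1, h1) \<in> K \<Longrightarrow> (g2, h2) \<in> K \<Longrightarrow> \<phi> (commutator G g1 g2) = commutator H h1 h2"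
proof -
  interpret G: group G by fact
  interpret H: group H by fact
  interpret ZG: normal "center G" G by (rule center_normal[OF G])
  interpret ZH: normal "center H" H by (rule center_normal[OF H])
  obtain \<theta> \<phi> where th: "\<theta> \<in> iso (G Mod center G) (H Mod center H)"
    and ph: "\<phi> \<in> iso (derived_group G) (derived_group H)"
    and comm: "\<And>g1 g2 h1 h2. g1 \<in> carrier G \<Longrightarrow> g2 \<in> carrier G \<Longrightarrow>
      h1 \<in> \<theta> (center G #>\<^bsub>G\<^esub> g1) \<Longrightarrow> h2 \<in> \<theta> (center G #>\<^bsub>G\<^esub> g2) \<Longrightarrow>
      \<phi> (commutator G g1 g2) = commutator H h1 h2"
    using iso unfolding isoclinic_def by blast
  define K where "K = {(g, h). g \<in> carrier G \<and> h \<in> carrier H \<and> \<theta> (center G #>\<^bsub>G\<^esub> g) = center H #>\<^bsub>H\<^esub> h}"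
  have bij: "bij_betw \<theta> (rcosets\<^bsub>G\<^esub> (center G)) (rcosets\<^bsub>H\<^esub> (center H))"
    using th by (simp add: iso_def FactGroup_def)
  have hom: "\<theta> \<in> hom (G Mod center G) (H Mod center H)"
    using th by (simp add: iso_def)
  have mult: "\<theta> (center G #>\<^bsub>G\<^esub> (g1 \<otimes>\<^bsub>G\<^esub> g2)) = \<theta> (center G #>\<^bsub>G\<^esub> g1) <#>\<^bsub>H\<^esub> \<theta> (center G #>\<^bsub>G\<^esub> g2)"
    if "g1 \<in> carrier G" "g2 \<in> carrier G" for g1 g2
    using hom_mult[OF hom, of "center G #>\<^bsub>G\<^esub> g1" "center G #>\<^bsub>G\<^esub> g2"] that
    by (simp add: FactGroup_def ZG.rcos_sum G.rcosetsI ZG.subset)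
  have one: "\<theta> (center G) = center H"
    using hom_one[OF hom ZG.factorgroup_is_group ZH.factorgroup_is_group] by (simp add: FactGroup_def)
  have unit: "center G #>\<^bsub>G\<^esub> \<one>\<^bsub>G\<^esub> = center G" "center H #>\<^bsub>H\<^esub> \<one>\<^bsub>H\<^esub> = center H"
    using ZG.subset ZH.subset by auto
  show ?thesis
  proof
    show "K \<subseteq> carrier G \<times> carrier H"
      by (auto simp: K_def)
    have "\<exists>h. (g, h) \<in> K" if g: "g \<in> carrier G" for g
    proof -
      have "\<theta> (center G #>\<^bsub>G\<^esub> g) \<in> rcosets\<^bsub>H\<^esub> (center H)"
        using bij G.rcosetsI[OF ZG.subset g] by (auto simp: bij_betw_def)
      then show ?thesis
        using g by (auto simp: K_def RCOSETS_def)
    qed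
    then show "fst ` K = carrier G"
      by (force simp: K_def)
    \<comment> \<open>Surjectivity of \<open>\<theta>\<close> provides \<open>g\<close> here; for
      the other projection any representative of the image coset serves.\<close>
    have "\<exists>g. (g, h) \<in> K" if h: "h \<in> carrier H" for h
    proof -
      have "center H #>\<^bsub>H\<^esub> h \<in> \<theta> ` (rcosets\<^bsub>G\<^esub> (center G))"
        using bij H.rcosetsI[OF ZH.subset h] by (simp add: bij_betw_def)
      then show ?thesis
        using h by (auto simp: K_def RCOSETS_def)
    qed
    then show "snd ` K = carrier H"
      by (force simp: K_def)
    show "(\<one>\<^bsub>G\<^esub>, \<one>\<^bsub>H\<^esub>) \<in> K"
      by (simp add: K_def unit one)
    show "k \<otimes>\<^bsub>G \<times>\<times> H\<^esub> l \<in> K" if "k \<in> K" "l \<in> K" for k l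
      using that by (auto simp: K_def mult ZH.rcos_sum)
    \<comment> \<open>\<open>\<theta>\<close> preserves the trivial coset, so membership means that
      the coset of \<open>z\<close> is \<open>center H\<close> itself.\<close>
    show "(\<one>\<^bsub>G\<^esub>, z) \<in> K \<longleftrightarrow> z \<in> center H" for z
    proof
      assume "(\<one>\<^bsub>G\<^esub>, z) \<in> K"
      then have "z \<in> carrier H" "center H = center H #>\<^bsub>H\<^esub> z"
        by (auto simp: K_def unit one)
      then show "z \<in> center H"
        using H.rcos_self[OF _ ZH.subgroup_axioms] by blast
    next
      assume z: "z \<in> center H"
      then have "z \<in> carrier H"
        using ZH.subset by blast
      then show "(\<one>\<^bsub>G\<^esub>, z) \<in> K"
        using z ZH.rcos_const by (simp add: K_def unit one)
    qed
    show "\<phi> \<in> hom (derived_group G) (derived_group H)"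
      using ph by (simp add: iso_def)
    \<comment> \<open>An \<open>h\<close> paired with \<open>g\<close> lies in its own coset, which
      is the image under \<open>\<theta>\<close> of the coset of \<open>g\<close>; this is the
      premise of \<open>comm\<close>.\<close>
    show "\<phi> (commutator G g1 g2) = commutator H h1 h2" if "(g1, h1) \<in> K" "(g2, h2) \<in> K" for g1 h1 g2 h2
      using that H.rcos_self[OF _ ZH.subgroup_axioms] by (intro comm) (auto simp: K_def)
  qed
qed

section \<open>Twisting a representation of \<open>H\<close> into one of \<open>G\<close>\<close>

text \<open>A multiple of \<open>\<rho> g\<close> preserves every subspace that
  \<open>\<rho> g\<close> preserves. In \<open>twisted_rep\<close> this carries irreducibility from
  \<open>\<sigma>\<close> over to \<open>\<rho>\<close>.\<close>

lemma invariant_subspace_scaled: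
  assumes G: "is_rep G n \<rho>"
    and H: "is_rep H n \<sigma>"
    and rel: "\<And>h. h \<in> carrier H \<Longrightarrow> \<exists>g\<in>carrier G. \<exists>c. \<sigma> h = c \<cdot>\<^sub>m \<rho> g"
    and W: "invariant_subspace G n \<rho> W"
  shows "invariant_subspace H n \<sigma> W"
  unfolding invariant_subspace_def
proof (intro conjI ballI allI)
  show "\<sigma> h *\<^sub>v v \<in> W" if h: "h \<in> carrier H" and v: "v \<in> W" for h v
  proof -
    obtain g c where g: "g \<in> carrier G" "\<sigma> h = c \<cdot>\<^sub>m \<rho> g"
      using rel[OF h] by blast
    moreover have "\<rho> g \<in> carrier_mat n n"
      using G g by (simp add: is_rep_def)
    moreover have "v \<in> carrier_vec n"
      using v W by (auto simp: invariant_subspace_def)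
    ultimately have "\<sigma> h *\<^sub>v v = c \<cdot>\<^sub>v (\<rho> g *\<^sub>v v)"
      by (simp add: smult_mat_mult_vec)
    then show ?thesis
      using W g v by (simp add: invariant_subspace_def)
  qed
qed (use W in \<open>auto simp: invariant_subspace_def\<close>)

lemma mat_trace_smult:
  assumes "A \<in> carrier_mat n n"
  shows "mat_trace (c \<cdot>\<^sub>m A) = c * mat_trace A"
  using assms by (simp add: mat_trace_def sum_distrib_left)

text \<open>Two partners of the same \<open>g\<close> differ by some \<open>z\<close> paired with
  the identity of \<open>G\<close>. Passing from one to the other multiplies \<open>\<sigma>\<close>
  and \<open>\<mu>\<close> by the same scalar, which cancels. Every \<open>h\<close> occurs in
  \<open>K\<close>, so every \<open>\<sigma> h\<close> is a multiple of some
  \<open>\<rho> g\<close>, and a subspace invariant under \<open>\<rho>\<close> is invariant under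
  \<open>\<sigma>\<close>.\<close>

lemma twisted_rep:
  fixes \<mu> :: "'a \<times> 'b \<Rightarrow> complex"
  assumes G: "group G" and H: "group H"
    and K: "subgroup K (G \<times>\<times> H)" "fst ` K = carrier G" "snd ` K = carrier H"
    and \<sigma>: "irreducible_rep H n \<sigma>"
    and \<mu>: "multiplicative_on (G \<times>\<times> H) K \<mu>" "\<And>k. k \<in> K \<Longrightarrow> \<mu> k \<noteq> 0"
    and scal: "\<And>z. (\<one>\<^bsub>G\<^esub>, z) \<in> K \<Longrightarrow> \<sigma> z = \<mu> (\<one>\<^bsub>G\<^esub>, z) \<cdot>\<^sub>m 1\<^sub>m n"
  obtains \<rho> where "irreducible_rep G n \<rho>"
    "\<And>g h. (g, h) \<in> K \<Longrightarrow> \<rho> g = inverse (\<mu> (g, h)) \<cdot>\<^sub>m \<sigma> h"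
proof -
  interpret G: group G by fact
  interpret H: group H by fact
  interpret K: subgroup K "G \<times>\<times> H" by fact
  have KI: "g \<in> carrier G" "h \<in> carrier H" if "(g, h) \<in> K" for g h
    using that K.subset by auto
  have Kmul: "(g \<otimes>\<^bsub>G\<^esub> g', h \<otimes>\<^bsub>H\<^esub> h') \<in> K" if "(g, h) \<in> K" "(g', h') \<in> K" for g h g' h'
    using K.m_closed[OF that] by simp
  have Kinv: "(inv\<^bsub>G\<^esub> g, inv\<^bsub>H\<^esub> h) \<in> K" if "(g, h) \<in> K" for g h
    using K.m_inv_closed[OF that] inv_DirProd[OF G H KI[OF that]] by simp
  have n: "n > 0" and rep: "is_rep H n \<sigma>"
    using \<sigma> by (auto simp: irreducible_rep_def)
  have car: "\<And>h. h \<in> carrier H \<Longrightarrow> \<sigma> h \<in> carrier_mat n n"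
    and mul: "\<And>h h'. h \<in> carrier H \<Longrightarrow> h' \<in> carrier H \<Longrightarrow> \<sigma> (h \<otimes>\<^bsub>H\<^esub> h') = \<sigma> h * \<sigma> h'"
    and one: "\<sigma> \<one>\<^bsub>H\<^esub> = 1\<^sub>m n"
    using rep by (auto simp: is_rep_def)
  have \<mu>_mul: "\<mu> (g \<otimes>\<^bsub>G\<^esub> g', h \<otimes>\<^bsub>H\<^esub> h') = \<mu> (g, h) * \<mu> (g', h')"
    if "(g, h) \<in> K" "(g', h') \<in> K" for g h g' h'
    using \<mu>(1) that unfolding multiplicative_on_def by force
  have wd: "inverse (\<mu> (g, h)) \<cdot>\<^sub>m \<sigma> h = inverse (\<mu> (g, h')) \<cdot>\<^sub>m \<sigma> h'"
    if gh: "(g, h) \<in> K" "(g, h') \<in> K" for g h h'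
  proof -
    define z where "z = h' \<otimes>\<^bsub>H\<^esub> inv\<^bsub>H\<^esub> h"
    have z: "(\<one>\<^bsub>G\<^esub>, z) \<in> K"
      using Kmul[OF gh(2) Kinv[OF gh(1)]] KI[OF gh(1)] by (simp add: z_def)
    have h': "h' = z \<otimes>\<^bsub>H\<^esub> h"
      using KI gh by (simp add: z_def H.m_assoc)
    have "\<mu> (g, h') = \<mu> (\<one>\<^bsub>G\<^esub>, z) * \<mu> (g, h)"
      using \<mu>_mul[OF z gh(1)] KI gh h' by simp
    moreover have "\<sigma> h' = \<mu> (\<one>\<^bsub>G\<^esub>, z) \<cdot>\<^sub>m \<sigma> h"
      using mul[of z h] KI z gh scal[OF z] h' car[of h]
      by (simp add: mult_smult_assoc_mat[of _ n n _ n])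
    ultimately show ?thesis
      using \<mu>(2)[OF z] \<mu>(2)[OF gh(1)] by (intro eq_matI) auto
  qed
  \<comment> \<open>\<open>s\<close> chooses an arbitrary partner of \<open>g\<close>; by
    \<open>wd\<close> every other partner gives the same matrix.\<close>
  define s where "s g = (SOME h. (g, h) \<in> K)" for g
  define \<rho> where "\<rho> g = inverse (\<mu> (g, s g)) \<cdot>\<^sub>m \<sigma> (s g)" for g
  have s: "(g, s g) \<in> K" if "g \<in> carrier G" for g
    unfolding s_def using that K(2) by (intro someI_ex[of "\<lambda>h. (g, h) \<in> K"]) force
  have \<rho>: "\<rho> g = inverse (\<mu> (g, h)) \<cdot>\<^sub>m \<sigma> h" if "(g, h) \<in> K" for g h
    unfolding \<rho>_def using that KI s by (intro wd) auto
  have repG: "is_rep G n \<rho>"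
    unfolding is_rep_def
  proof (intro conjI ballI)
    show "\<rho> g \<in> carrier_mat n n" if "g \<in> carrier G" for g
      using car KI s[OF that] by (simp add: \<rho>_def)
    show "\<rho> (g \<otimes>\<^bsub>G\<^esub> g') = \<rho> g * \<rho> g'" if g: "g \<in> carrier G" "g' \<in> carrier G" for g g'
    proof -
      note sg = s[OF g(1)] s[OF g(2)]
      have A: "\<sigma> (s g) \<in> carrier_mat n n" "\<sigma> (s g') \<in> carrier_mat n n"
        using KI sg car by blast+
      \<comment> \<open>The product of the chosen partners is a partner of the product, perhaps not
        the chosen one; the fact \<open>\<rho>\<close> covers this.\<close>
      have "\<rho> (g \<otimes>\<^bsub>G\<^esub> g') = inverse (\<mu> (g, s g) * \<mu> (g', s g')) \<cdot>\<^sub>m (\<sigma> (s g) * \<sigma> (s g'))"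
        using \<rho>[OF Kmul[OF sg]] \<mu>_mul[OF sg] mul KI sg by simp
      also have "\<dots> = \<rho> g * \<rho> g'"
        unfolding \<rho>_def using A
        by (subst mult_smult_distrib[of _ n n _ n] mult_smult_assoc_mat[of _ n n _ n]; simp)+
          (intro eq_matI; simp)
      finally show ?thesis .
    qed
    have k1: "(\<one>\<^bsub>G\<^esub>, \<one>\<^bsub>H\<^esub>) \<in> K"
      using K.one_closed by simp
    \<comment> \<open>The value of \<open>\<mu>\<close> at the identity is idempotent and
      nonzero.\<close>
    have "\<mu> (\<one>\<^bsub>G\<^esub>, \<one>\<^bsub>H\<^esub>) = 1"
      using \<mu>_mul[OF k1 k1] \<mu>(2)[OF k1] by simp
    then show "\<rho> \<one>\<^bsub>G\<^esub> = 1\<^sub>m n"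
      using \<rho>[OF k1] one by (intro eq_matI) auto
  qed
  have "\<exists>g\<in>carrier G. \<exists>c. \<sigma> h = c \<cdot>\<^sub>m \<rho> g" if h: "h \<in> carrier H" for h
  proof -
    obtain g where g: "(g, h) \<in> K"
      using K(3) h by force
    then have "\<sigma> h = \<mu> (g, h) \<cdot>\<^sub>m \<rho> g"
      using \<mu>(2)[OF g] by (subst \<rho>[OF g]) (intro eq_matI; simp)
    then show ?thesis
      using KI g by blast
  qed
  then have "invariant_subspace H n \<sigma> W" if "invariant_subspace G n \<rho> W" for W
    using invariant_subspace_scaled[OF repG rep _ that] by blast
  then have "irreducible_rep G n \<rho>"
    using \<sigma> repG n unfolding irreducible_rep_def by blast
  then show ?thesis
    using that \<rho> by blast
qed

section \<open>The central character of \<open>\<sigma>\<close> and its extension to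
  \<open>K\<close>\<close>

lemma schur_central_character:
  assumes "group H" and irr: "irreducible_rep H n \<sigma>"
  obtains l where "multiplicative_on H (center H) l" "l \<one>\<^bsub>H\<^esub> = 1"
    "\<And>z. z \<in> center H \<Longrightarrow> \<sigma> z = l z \<cdot>\<^sub>m 1\<^sub>m n"
proof -
  interpret H: group H by fact
  interpret Z: normal "center H" H by (rule center_normal[OF assms(1)])
  have n: "n > 0" and rep: "is_rep H n \<sigma>"
    using irr by (auto simp: irreducible_rep_def)
  \<comment> \<open>The scalar from Schur's lemma is read off at entry (0, 0), which exists since
    \<open>n > 0\<close>.\<close>
  define l where "l z = \<sigma> z $$ (0, 0)" for z
  have l: "\<sigma> z = l z \<cdot>\<^sub>m 1\<^sub>m n" if "z \<in> center H" for z
    using schur_central[OF irr that] n by (auto simp: l_def)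
  have "multiplicative_on H (center H) l"
    unfolding multiplicative_on_def
  proof (intro ballI)
    fix x y assume xy: "x \<in> center H" "y \<in> center H"
    have \<sigma>y: "\<sigma> y \<in> carrier_mat n n"
      using rep xy Z.subset by (auto simp: is_rep_def)
    have "\<sigma> (x \<otimes>\<^bsub>H\<^esub> y) = \<sigma> x * \<sigma> y"
      using rep xy Z.subset by (auto simp: is_rep_def)
    also have "\<dots> = l x \<cdot>\<^sub>m \<sigma> y"
      unfolding l[OF xy(1)] using \<sigma>y by (simp add: mult_smult_assoc_mat[of _ n n _ n])
    finally show "l (x \<otimes>\<^bsub>H\<^esub> y) = l x * l y"
      using n \<sigma>y by (simp add: l_def)
  qed
  moreover have "l \<one>\<^bsub>H\<^esub> = 1"
    using rep n by (simp add: l_def is_rep_def)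
  ultimately show ?thesis
    using that l by blast
qed

text \<open>The quotient of \<open>y\<close> by \<open>\<phi> x\<close> measures how far
  \<open>(x, y)\<close> is from the graph of \<open>\<phi>\<close>. Where it is defined and central,
  applying \<open>l\<close> to it is multiplicative. It is trivial on the commutators of
  \<open>K\<close>, which lie on the graph, so \<open>extend_character\<close> applies; finiteness
  of \<open>K\<close> gives modulus 1.\<close>

lemma isoclinic_linear_character:
  assumes G: "group G" and H: "group H" and fin: "finite (carrier G)" "finite (carrier H)"
    and K: "subgroup K (G \<times>\<times> H)"
    and ker: "\<And>z. (\<one>\<^bsub>G\<^esub>, z) \<in> K \<longleftrightarrow> z \<in> center H"
    and \<phi>: "\<phi> \<in> hom (derived_group G) (derived_group H)"
    and comm: "\<And>g1 h1 g2 h2. (g1, h1) \<in> K \<Longrightarrow> (g2, h2) \<in> K \<Longrightarrow>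
      \<phi> (commutator G g1 g2) = commutator H h1 h2"
    and l: "multiplicative_on H (center H) l" "l \<one>\<^bsub>H\<^esub> = (1::complex)"
  obtains \<mu> where "multiplicative_on (G \<times>\<times> H) K \<mu>" "\<And>k. k \<in> K \<Longrightarrow> cmod (\<mu> k) = 1"
    "\<And>z. z \<in> center H \<Longrightarrow> \<mu> (\<one>\<^bsub>G\<^esub>, z) = l z"
proof -
  interpret G: group G by fact
  interpret H: group H by fact
  interpret Z: normal "center H" H by (rule center_normal[OF H])
  interpret P: group "G \<times>\<times> H" by (rule DirProd_group[OF G H])
  interpret K: subgroup K "G \<times>\<times> H" by fact
  \<comment> \<open>\<open>K\<close> becomes a group of its own, so that the extension lemma can
    take it as the ambient group.\<close>
  define KG where "KG = (G \<times>\<times> H)\<lparr>carrier := K\<rparr>"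
  have KG: "carrier KG = K" "\<one>\<^bsub>KG\<^esub> = (\<one>\<^bsub>G\<^esub>, \<one>\<^bsub>H\<^esub>)"
    "\<And>g h g' h'. (g, h) \<otimes>\<^bsub>KG\<^esub> (g', h') = (g \<otimes>\<^bsub>G\<^esub> g', h \<otimes>\<^bsub>H\<^esub> h')"
    by (simp_all add: KG_def)
  interpret KG: group KG
    unfolding KG_def by (rule K.subgroup_is_group) (rule P.group_axioms)
  have KI: "g \<in> carrier G" "h \<in> carrier H" if "(g, h) \<in> K" for g h
    using that K.subset by auto
  have Kmul: "(g \<otimes>\<^bsub>G\<^esub> g', h \<otimes>\<^bsub>H\<^esub> h') \<in> K" if "(g, h) \<in> K" "(g', h') \<in> K" for g h g' h'
    using K.m_closed[OF that] by simp
  have Kinv: "(inv\<^bsub>G\<^esub> g, inv\<^bsub>H\<^esub> h) \<in> K" if "(g, h) \<in> K" for g h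
    using K.m_inv_closed[OF that] inv_DirProd[OF G H KI[OF that]] by simp
  have finK: "finite (carrier KG)"
    using K.subset fin by (auto simp: KG intro: finite_subset)
  define D where "D = derived G (carrier G)"
  interpret D: subgroup D G
    unfolding D_def by (rule G.derived_is_subgroup) simp
  have \<phi>_in: "\<phi> x \<in> carrier H" if "x \<in> D" for x
    using \<phi> that H.derived_in_carrier[of "carrier H"] by (auto simp: hom_def derived_group_def D_def)
  have \<phi>_mul: "\<phi> (x \<otimes>\<^bsub>G\<^esub> y) = \<phi> x \<otimes>\<^bsub>H\<^esub> \<phi> y" if "x \<in> D" "y \<in> D" for x y
    using \<phi> that by (auto simp: hom_def derived_group_def D_def)
  have \<phi>_one: "\<phi> \<one>\<^bsub>G\<^esub> = \<one>\<^bsub>H\<^esub>"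
    using \<phi>_mul[OF D.one_closed D.one_closed] \<phi>_in[OF D.one_closed] H.l_cancel_one' by auto
  \<comment> \<open>\<open>L\<close> contains the commutators of \<open>K\<close>, on which \<open>f\<close> is trivial, as well as \<open>1 \<times> Z(H)\<close>, on which \<open>f\<close> is \<open>l\<close>.\<close>
  define L where "L = {(x, y). (x, y) \<in> K \<and> x \<in> D \<and> y \<otimes>\<^bsub>H\<^esub> inv\<^bsub>H\<^esub> (\<phi> x) \<in> center H}"
  define f where "f = (\<lambda>(x, y). l (y \<otimes>\<^bsub>H\<^esub> inv\<^bsub>H\<^esub> (\<phi> x)))"
  \<comment> \<open>The second defect is central and so moves past the inverse of
    \<open>\<phi> x\<close>.\<close>
  have defect: "(y \<otimes>\<^bsub>H\<^esub> y') \<otimes>\<^bsub>H\<^esub> inv\<^bsub>H\<^esub> (\<phi> (x \<otimes>\<^bsub>G\<^esub> x')) =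
      (y \<otimes>\<^bsub>H\<^esub> inv\<^bsub>H\<^esub> (\<phi> x)) \<otimes>\<^bsub>H\<^esub> (y' \<otimes>\<^bsub>H\<^esub> inv\<^bsub>H\<^esub> (\<phi> x'))"
    if "(x, y) \<in> L" "(x', y') \<in> L" for x y x' y'
  proof -
    have c: "x \<in> D" "x' \<in> D" "y \<in> carrier H" "y' \<in> carrier H" "\<phi> x \<in> carrier H" "\<phi> x' \<in> carrier H"
      using that KI \<phi>_in by (auto simp: L_def)
    define w where "w = y' \<otimes>\<^bsub>H\<^esub> inv\<^bsub>H\<^esub> (\<phi> x')"
    have "w \<in> center H"
      using that by (simp add: L_def w_def)
    then have w: "w \<in> carrier H" "w \<otimes>\<^bsub>H\<^esub> inv\<^bsub>H\<^esub> (\<phi> x) = inv\<^bsub>H\<^esub> (\<phi> x) \<otimes>\<^bsub>H\<^esub> w"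
      using H.inv_closed[OF c(5)] unfolding center_def by blast+
    have "(y \<otimes>\<^bsub>H\<^esub> y') \<otimes>\<^bsub>H\<^esub> inv\<^bsub>H\<^esub> (\<phi> (x \<otimes>\<^bsub>G\<^esub> x')) = y \<otimes>\<^bsub>H\<^esub> (w \<otimes>\<^bsub>H\<^esub> inv\<^bsub>H\<^esub> (\<phi> x))"
      using c by (simp add: \<phi>_mul H.inv_mult_group H.m_assoc w_def)
    also have "\<dots> = (y \<otimes>\<^bsub>H\<^esub> inv\<^bsub>H\<^esub> (\<phi> x)) \<otimes>\<^bsub>H\<^esub> w"
      using c w by (simp add: H.m_assoc)
    finally show ?thesis
      by (simp add: w_def)
  qed
  have L: "subgroup L KG"
  proof (rule KG.finite_closed_subgroup[OF finK])
    show "L \<subseteq> carrier KG"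
      by (auto simp: L_def KG)
    show "\<one>\<^bsub>KG\<^esub> \<in> L"
      using K.one_closed by (simp add: L_def KG \<phi>_one)
    show "k \<otimes>\<^bsub>KG\<^esub> k' \<in> L" if kk: "k \<in> L" "k' \<in> L" for k k'
    proof -
      obtain x y x' y' where k: "k = (x, y)" "k' = (x', y')"
        by fastforce
      show ?thesis
        using kk Kmul[of x y x' y'] defect[of x y x' y'] unfolding k KG L_def by auto
    qed
  qed
  have f: "multiplicative_on KG L f"
    unfolding multiplicative_on_def
  proof (intro ballI)
    fix k k' assume kk: "k \<in> L" "k' \<in> L"
    obtain x y x' y' where k: "k = (x, y)" "k' = (x', y')"
      by fastforce
    show "f (k \<otimes>\<^bsub>KG\<^esub> k') = f k * f k'"
      using kk defect[of x y x' y'] l(1) unfolding k KG f_def multiplicative_on_def L_def by auto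
  qed
  have f_one: "f \<one>\<^bsub>KG\<^esub> = 1"
    by (simp add: f_def KG \<phi>_one l)
  have commK: "\<exists>c\<in>L. f c = 1 \<and> k \<otimes>\<^bsub>KG\<^esub> k' = c \<otimes>\<^bsub>KG\<^esub> (k' \<otimes>\<^bsub>KG\<^esub> k)"
    if kk: "k \<in> carrier KG" "k' \<in> carrier KG" for k k'
  proof -
    obtain x y x' y' where k: "k = (x, y)" "k' = (x', y')"
      by fastforce
    have k': "(x, y) \<in> K" "(x', y') \<in> K"
      using kk by (auto simp: k KG)
    note xy = KI[OF k'(1)] KI[OF k'(2)]
    define u v where "u = x \<otimes>\<^bsub>G\<^esub> x' \<otimes>\<^bsub>G\<^esub> inv\<^bsub>G\<^esub> x \<otimes>\<^bsub>G\<^esub> inv\<^bsub>G\<^esub> x'"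
      and "v = y \<otimes>\<^bsub>H\<^esub> y' \<otimes>\<^bsub>H\<^esub> inv\<^bsub>H\<^esub> y \<otimes>\<^bsub>H\<^esub> inv\<^bsub>H\<^esub> y'"
    have uv: "(u, v) \<in> K"
      unfolding u_def v_def using k' by (intro Kmul Kinv)
    have uD: "u \<in> D"
      unfolding D_def derived_def u_def using xy by (intro generate.incl) blast
    \<comment> \<open>\<open>commutator\<close> starts with inverses, whereas the generators of
      \<open>derived\<close> end with them; hence compatibility with \<open>\<phi>\<close> is
      applied to the inverse pairs.\<close>
    have "\<phi> u = v"
      using comm[OF Kinv[OF k'(1)] Kinv[OF k'(2)]] xy by (simp add: commutator_def u_def v_def)
    then have "v \<otimes>\<^bsub>H\<^esub> inv\<^bsub>H\<^esub> (\<phi> u) = \<one>\<^bsub>H\<^esub>"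
      using KI(2)[OF uv] by simp
    then have "(u, v) \<in> L" "f (u, v) = 1"
      using uv uD by (simp_all add: L_def f_def l)
    moreover have "x \<otimes>\<^bsub>G\<^esub> x' = u \<otimes>\<^bsub>G\<^esub> (x' \<otimes>\<^bsub>G\<^esub> x)"
      using xy by (simp add: u_def G.commutator_swap)
    moreover have "y \<otimes>\<^bsub>H\<^esub> y' = v \<otimes>\<^bsub>H\<^esub> (y' \<otimes>\<^bsub>H\<^esub> y)"
      using xy by (simp add: v_def H.commutator_swap)
    ultimately show ?thesis
      by (intro bexI[of _ "(u, v)"]) (simp_all add: k KG)
  qed
  obtain \<mu> where \<mu>: "multiplicative_on KG (carrier KG) \<mu>" "\<forall>k\<in>L. \<mu> k = f k"
    using KG.extend_character[OF finK L f f_one commK] by blast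
  have \<mu>_one: "\<mu> \<one>\<^bsub>KG\<^esub> = 1"
    using \<mu>(2) f_one subgroup.one_closed[OF L] by simp
  show ?thesis
  proof
    show "multiplicative_on (G \<times>\<times> H) K \<mu>"
      using \<mu>(1) by (simp add: KG_def multiplicative_on_def)
    show "cmod (\<mu> k) = 1" if "k \<in> K" for k
      using KG.norm_multiplicative[OF finK \<mu>(1) \<mu>_one] that by (simp add: KG)
    show "\<mu> (\<one>\<^bsub>G\<^esub>, z) = l z" if z: "z \<in> center H" for z
    proof -
      have "z \<in> carrier H"
        using z Z.subset by blast
      \<comment> \<open>Since \<open>\<phi>\<close> preserves the identity, the defect of this pair
        is \<open>z\<close> itself, and \<open>f\<close> takes the value \<open>l z\<close>
        there.\<close>
      moreover from this have "(\<one>\<^bsub>G\<^esub>, z) \<in> L"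
        using z ker by (simp add: L_def \<phi>_one)
      ultimately show ?thesis
        using \<mu>(2) by (simp add: f_def \<phi>_one)
    qed
  qed
qed

section \<open>Transfer of irreducible characters and of the two properties\<close>

text \<open>The twisted representation affords \<open>\<chi>\<close>: its traces differ from those
  of \<open>\<sigma>\<close> by scalars of modulus 1, and at the identities both characters give the
  degree. One \<open>K\<close> serves all \<open>\<psi>\<close>, so several characters can be
  compared at the same pair.\<close>

lemma isoclinic_Irr_transfer:
  assumes G: "group G" and H: "group H" and fin: "finite (carrier G)" "finite (carrier H)"
    and iso: "isoclinic G H"
  obtains K where "fst ` K = carrier G" "snd ` K = carrier H"
    "\<And>\<psi>. \<psi> \<in> Irr H \<Longrightarrow> \<exists>\<chi>\<in>Irr G. \<chi> \<one>\<^bsub>G\<^esub> = \<psi> \<one>\<^bsub>H\<^esub> \<and> (\<forall>(g, h)\<in>K. cmod (\<chi> g) = cmod (\<psi> h))"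
proof -
  obtain K \<phi> where K: "K \<subseteq> carrier G \<times> carrier H" "fst ` K = carrier G" "snd ` K = carrier H"
      "(\<one>\<^bsub>G\<^esub>, \<one>\<^bsub>H\<^esub>) \<in> K" "\<And>k l. k \<in> K \<Longrightarrow> l \<in> K \<Longrightarrow> k \<otimes>\<^bsub>G \<times>\<times> H\<^esub> l \<in> K"
    and ker: "\<And>z. (\<one>\<^bsub>G\<^esub>, z) \<in> K \<longleftrightarrow> z \<in> center H"
    and \<phi>: "\<phi> \<in> hom (derived_group G) (derived_group H)"
      "\<And>g1 h1 g2 h2. (g1, h1) \<in> K \<Longrightarrow> (g2, h2) \<in> K \<Longrightarrow> \<phi> (commutator G g1 g2) = commutator H h1 h2"
    by (rule isoclinic_fibre_product[OF G H iso]) blast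
  have sub: "subgroup K (G \<times>\<times> H)"
    by (rule group.finite_closed_subgroup[OF DirProd_group[OF G H]]) (use K fin in auto)
  have "\<exists>\<chi>\<in>Irr G. \<chi> \<one>\<^bsub>G\<^esub> = \<psi> \<one>\<^bsub>H\<^esub> \<and> (\<forall>(g, h)\<in>K. cmod (\<chi> g) = cmod (\<psi> h))"
    if "\<psi> \<in> Irr H" for \<psi>
  proof -
    obtain n \<sigma> where \<sigma>: "irreducible_rep H n \<sigma>"
      and \<psi>: "\<psi> = (\<lambda>h. if h \<in> carrier H then mat_trace (\<sigma> h) else 0)"
      using \<open>\<psi> \<in> Irr H\<close> by (auto simp: Irr_def)
    obtain l where l: "multiplicative_on H (center H) l" "l \<one>\<^bsub>H\<^esub> = 1"
      "\<And>z. z \<in> center H \<Longrightarrow> \<sigma> z = l z \<cdot>\<^sub>m 1\<^sub>m n"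
      by (rule schur_central_character[OF H \<sigma>]) blast
    obtain \<mu> where \<mu>: "multiplicative_on (G \<times>\<times> H) K \<mu>" "\<And>k. k \<in> K \<Longrightarrow> cmod (\<mu> k) = 1"
      "\<And>z. z \<in> center H \<Longrightarrow> \<mu> (\<one>\<^bsub>G\<^esub>, z) = l z"
      by (rule isoclinic_linear_character[OF G H fin sub ker \<phi> l(1,2)]) blast+
    have nz: "\<mu> k \<noteq> 0" if "k \<in> K" for k
      using \<mu>(2)[OF that] by auto
    have scal: "\<sigma> z = \<mu> (\<one>\<^bsub>G\<^esub>, z) \<cdot>\<^sub>m 1\<^sub>m n" if "(\<one>\<^bsub>G\<^esub>, z) \<in> K" for z
      using that l(3) \<mu>(3) ker by simp
    obtain \<rho> where \<rho>: "irreducible_rep G n \<rho>"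
      "\<And>g h. (g, h) \<in> K \<Longrightarrow> \<rho> g = inverse (\<mu> (g, h)) \<cdot>\<^sub>m \<sigma> h"
      by (rule twisted_rep[OF G H sub K(2,3) \<sigma> \<mu>(1) nz scal]) blast+
    define \<chi> where "\<chi> = (\<lambda>g. if g \<in> carrier G then mat_trace (\<rho> g) else 0)"
    have car: "\<sigma> h \<in> carrier_mat n n" if "h \<in> carrier H" for h
      using \<sigma> that by (auto simp: irreducible_rep_def is_rep_def)
    have "\<chi> \<in> Irr G"
      using \<rho>(1) by (auto simp: Irr_def \<chi>_def)
    moreover have "\<chi> \<one>\<^bsub>G\<^esub> = \<psi> \<one>\<^bsub>H\<^esub>"
      using \<rho>(1) \<sigma> K(1,4) by (auto simp: \<chi>_def \<psi> irreducible_rep_def is_rep_def)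
    moreover have "cmod (\<chi> g) = cmod (\<psi> h)" if gh: "(g, h) \<in> K" for g h
    proof -
      have "g \<in> carrier G" "h \<in> carrier H"
        using gh K(1) by auto
      then have "\<chi> g = inverse (\<mu> (g, h)) * \<psi> h"
        using \<rho>(2)[OF gh] mat_trace_smult[OF car] by (simp add: \<chi>_def \<psi>)
      then show ?thesis
        using \<mu>(2)[OF gh] by (simp add: norm_mult norm_inverse)
    qed
    ultimately show ?thesis
      by (intro bexI[of _ \<chi>]) auto
  qed
  then show ?thesis
    using that K(2,3) by blast
qed

theorem theorem1p4:
  fixes G :: "('a, 'c) monoid_scheme" and H :: "('b, 'd) monoid_scheme"
  assumes "group G" and "group H"
    and "finite (carrier G)" and "finite (carrier H)"
    and "isoclinic G H"
  shows "(GVZ G \<longrightarrow> GVZ H) \<and> (nested G \<and> GVZ G \<longrightarrow> nested H \<and> GVZ H)"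
proof -
  obtain K where K: "fst ` K = carrier G" "snd ` K = carrier H"
    and transfer: "\<And>\<psi>. \<psi> \<in> Irr H \<Longrightarrow>
      \<exists>\<chi>\<in>Irr G. \<chi> \<one>\<^bsub>G\<^esub> = \<psi> \<one>\<^bsub>H\<^esub> \<and> (\<forall>(g, h)\<in>K. cmod (\<chi> g) = cmod (\<psi> h))"
    by (rule isoclinic_Irr_transfer[OF assms]) blast
  have KI: "g \<in> carrier G" "h \<in> carrier H" if "(g, h) \<in> K" for g h
    using that K by force+
  have lift: "\<exists>g. (g, h) \<in> K" if "h \<in> carrier H" for h
    using that K(2) by force
  \<comment> \<open>Absolute values and degrees agree along \<open>K\<close>, hence so do the
    conditions defining the character centers.\<close>
  have match: "\<exists>\<chi>\<in>Irr G. (\<forall>(g, h)\<in>K. cmod (\<chi> g) = cmod (\<psi> h)) \<and>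
      (\<forall>(g, h)\<in>K. g \<in> char_center G \<chi> \<longleftrightarrow> h \<in> char_center H \<psi>)" if \<psi>: "\<psi> \<in> Irr H" for \<psi>
  proof -
    obtain \<chi> where \<chi>: "\<chi> \<in> Irr G" "\<chi> \<one>\<^bsub>G\<^esub> = \<psi> \<one>\<^bsub>H\<^esub>" "\<forall>(g, h)\<in>K. cmod (\<chi> g) = cmod (\<psi> h)"
      using transfer[OF \<psi>] by blast
    have "\<forall>(g, h)\<in>K. g \<in> char_center G \<chi> \<longleftrightarrow> h \<in> char_center H \<psi>"
      using \<chi>(2,3) KI by (fastforce simp: char_center_def)
    then show ?thesis
      using \<chi> by blast
  qed
  have "GVZ H" if "GVZ G"
    unfolding GVZ_def
  proof (intro ballI)
    fix \<psi> h assume \<psi>: "\<psi> \<in> Irr H" and h: "h \<in> carrier H - char_center H \<psi>"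
    obtain g where g: "(g, h) \<in> K"
      using lift h by blast
    obtain \<chi> where \<chi>: "\<chi> \<in> Irr G" "cmod (\<chi> g) = cmod (\<psi> h)"
      "g \<in> char_center G \<chi> \<longleftrightarrow> h \<in> char_center H \<psi>"
      using match[OF \<psi>] g by blast
    then have "\<chi> g = 0"
      using \<open>GVZ G\<close> h KI[OF g] unfolding GVZ_def by blast
    then show "\<psi> h = 0"
      using \<chi>(2) by simp
  qed
  moreover have "nested H" if "nested G"
    unfolding nested_def
  proof (intro ballI)
    fix \<psi>1 \<psi>2 assume \<psi>: "\<psi>1 \<in> Irr H" "\<psi>2 \<in> Irr H"
    obtain \<chi>1 where \<chi>1: "\<chi>1 \<in> Irr G" "\<forall>(g, h)\<in>K. g \<in> char_center G \<chi>1 \<longleftrightarrow> h \<in> char_center H \<psi>1"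
      using match[OF \<psi>(1)] by blast
    obtain \<chi>2 where \<chi>2: "\<chi>2 \<in> Irr G" "\<forall>(g, h)\<in>K. g \<in> char_center G \<chi>2 \<longleftrightarrow> h \<in> char_center H \<psi>2"
      using match[OF \<psi>(2)] by blast
    have c: "char_center H \<psi> \<subseteq> carrier H" for \<psi>
      by (auto simp: char_center_def)
    have "char_center G \<chi>1 \<subseteq> char_center G \<chi>2 \<or> char_center G \<chi>2 \<subseteq> char_center G \<chi>1"
      using \<open>nested G\<close> \<chi>1(1) \<chi>2(1) unfolding nested_def by blast
    \<comment> \<open>A single partner \<open>g\<close> of \<open>h\<close> tests membership for
      both characters, so the inclusion in \<open>G\<close> passes to \<open>H\<close>.\<close>
    then show "char_center H \<psi>1 \<subseteq> char_center H \<psi>2 \<or> char_center H \<psi>2 \<subseteq> char_center H \<psi>1"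
      using \<chi>1(2) \<chi>2(2) lift c by blast
  qed
  ultimately show ?thesis
    by blast
qed

end
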